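(* Let $\mu$ and $\nu$ be two non-trivial probability measures on $\partial\mathbb{D}$. Let $\{\alpha_n(\mu)\}$ and $\{\alpha_n(\nu)\}$, respectively, be their Verblunsky coefficients and let $\Phi_n^*(\mu)$ and $\Phi_n^*(\nu)$, respectively, be their reversed monic orthogonal polynomials. Then $$\frac{\Phi_{n+1}^*(\mu)}{\Phi_n^*(\mu)}-\frac{\Phi_{n+1}^*(\nu)}{\Phi_n^*(\nu)}\to 0$$ uniformly on compact subsets of $\mathbb{D}$ as $n\to\infty$ if and only if for every $\ell\ge 1$ $$\lim_{n\to\infty}\big[\alpha_n(\mu)\bar\alpha_{n-\ell}(\mu)-\alpha_n(\nu)\bar\alpha_{n-\ell}(\nu)\big]=0.$$
   Context: $\mathbb{D}=\{|z|<1\}$. A probability measure on $\partial\mathbb{D}$ is non-trivial if its support is infinite. For such a measure, $\Phi_n$ ($n\ge 0$) are its monic orthogonal polynomials, $\Phi_n^*(z)=z^n\overline{\Phi_n(1/\bar z)}$ the reversed polynomials (which have no zeros in $\mathbb{D}$), and the Verblunsky coefficients $\alpha_n\in\mathbb{D}$, $n\ge0$, are defined by $\Phi_{n+1}(z)=z\Phi_n(z)-\bar\alpha_n\Phi_n^*(z)$. By convention $\alpha_{-1}=-1$ and $\alpha_n=0$ for $n\le-2$. *)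

theory Defs
  imports "HOL-Probability.Probability" "HOL-Computational_Algebra.Polynomial"
begin

definition measure_support :: "'a::topological_space measure \<Rightarrow> 'a set" where
  "measure_support M = {x \<in> space M. \<forall>U. open U \<and> x \<in> U \<longrightarrow> emeasure M (U \<inter> space M) > 0}"

definition nontrivial_circle_prob :: "complex measure \<Rightarrow> bool" where
  "nontrivial_circle_prob M \<longleftrightarrow>
     prob_space M \<and> sets M = sets (restrict_space borel (sphere 0 1)) \<and> infinite (measure_support M)"

definition is_monic_OPs :: "complex measure \<Rightarrow> (nat \<Rightarrow> complex poly) \<Rightarrow> bool" where
  "is_monic_OPs M P \<longleftrightarrow>
     (\<forall>n. degree (P n) = n \<and> lead_coeff (P n) = 1) \<and>
     (\<forall>m n. m \<noteq> n \<longrightarrow> (LINT z|M. cnj (poly (P m) z) * poly (P n) z) = 0)"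

text \<open>The family described here exists and is unique when the measure is non-trivial.\<close>

definition monic_OP :: "complex measure \<Rightarrow> nat \<Rightarrow> complex poly" where
  "monic_OP M = (THE P. is_monic_OPs M P)"

text \<open>The reversal is taken at the actual degree, which is \<open>n\<close> for the \<open>n\<close>-th monic orthogonal
  polynomial. The lemma below is the usual defining formula; it determines the
  polynomial because it holds for infinitely many points.\<close>

definition reversed_poly :: "complex poly \<Rightarrow> complex poly" where
  "reversed_poly p = reflect_poly (map_poly cnj p)"

lemma poly_reversed_poly:
  assumes "z \<noteq> 0"
  shows "poly (reversed_poly p) z = z ^ degree p * cnj (poly p (1 / cnj z))"
proof -
  have "poly (map_poly cnj p) (inverse z) = cnj (poly p (1 / cnj z))"
    by (simp add: inverse_eq_divide)
  moreover have "degree (map_poly cnj p) = degree p"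
    by (simp add: degree_map_poly)
  ultimately show ?thesis
    using assms by (simp add: reversed_poly_def poly_reflect_poly_nz)
qed

definition reversed_OP :: "complex measure \<Rightarrow> nat \<Rightarrow> complex poly" where
  "reversed_OP M n = reversed_poly (monic_OP M n)"

text \<open>Integer indices accommodate the convention for negative ones. For \<open>k \<ge> 0\<close> the description
  is the Szego recursion, which has exactly one solution when the measure is non-trivial.\<close>

definition verblunsky :: "complex measure \<Rightarrow> int \<Rightarrow> complex" where
  "verblunsky M k =
     (if k \<ge> 0 then
        (THE a. monic_OP M (Suc (nat k)) =
           [:0, 1:] * monic_OP M (nat k) - smult (cnj a) (reversed_OP M (nat k)))
      else if k = -1 then -1
      else 0)"

end

theory Submission
  imports Defs "HOL-Complex_Analysis.Complex_Analysis"
begin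

text \<open>
  Put \<open>f\<^sub>n = \<Phi>\<^sub>n / \<Phi>\<^sub>n\<^sup>*\<close>. The reversed Szego recursion says that
  \<open>\<Phi>\<^bsub>n+1\<^esub>\<^sup>* / \<Phi>\<^sub>n\<^sup>* = 1 - \<alpha>\<^sub>n z f\<^sub>n\<close>, and the two recursions together say that \<open>f\<^bsub>n+1\<^esub>\<close> is the
  Moebius transform \<open>(z f\<^sub>n - cnj \<alpha>\<^sub>n) / (1 - \<alpha>\<^sub>n z f\<^sub>n)\<close>. As \<open>f\<^sub>0 = 1\<close> and \<open>|\<alpha>\<^sub>n| < 1\<close>, every \<open>f\<^sub>n\<close>
  is bounded by one on the disc, so the uniform convergence of the difference of ratios is the
  convergence to zero of each Taylor coefficient of \<open>\<alpha>\<^sub>n(\<mu>) f\<^sub>n(\<mu>) - \<alpha>\<^sub>n(\<nu>) f\<^sub>n(\<nu>)\<close>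
  (\<open>locally_uniform_limit_iff_fps_nth_tendsto\<close>).

  This condition and the one on the products \<open>\<alpha>\<^sub>n cnj \<alpha>\<^bsub>n-l\<^esub>\<close> are compared along subsequences. Every
  sequence of indices has a subsequence along which all \<open>\<alpha>\<^bsub>n-m\<^esub>\<close> converge to some \<open>A\<^sub>m\<close> and all
  \<open>f\<^bsub>n+1-m\<^esub>\<close> converge coefficientwise to some \<open>G\<^sub>m\<close> (\<open>schur_flow_right_limits\<close>); similarly \<open>B\<^sub>m\<close>
  and \<open>H\<^sub>m\<close> for the other measure. The limits satisfy
  \<open>G\<^sub>m (1 - A\<^sub>m z G\<^bsub>m+1\<^esub>) = z G\<^bsub>m+1\<^esub> - cnj A\<^sub>m\<close>, and an exact statement remains.

  If \<open>A\<^sub>m G\<^bsub>m+1\<^esub> = B\<^sub>m H\<^bsub>m+1\<^esub>\<close> for all \<open>m\<close>, then the relation between \<open>G\<^sub>m\<close> and \<open>G\<^bsub>m+1\<^esub>\<close> becomes linear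
  with the same coefficients for both chains, whence \<open>A\<^sub>0 G\<^sub>l = B\<^sub>0 H\<^sub>l\<close> for \<open>l \<ge> 1\<close>; constant terms
  give \<open>A\<^sub>0 cnj A\<^sub>l = B\<^sub>0 cnj B\<^sub>l\<close> (\<open>schur_chain_products_eq\<close>). Conversely, suppose that
  \<open>A\<^sub>p cnj A\<^sub>q = B\<^sub>p cnj B\<^sub>q\<close> for all \<open>p < q\<close>. If at most one \<open>A\<^sub>p\<close> with \<open>p \<ge> 1\<close> is nonzero, then the
  coefficients of \<open>G\<^sub>1\<close> are the \<open>- cnj A\<^sub>p\<close> themselves. If two are, then either \<open>A\<^sub>0 = B\<^sub>0 = 0\<close>, or
  three nonzero parameters force \<open>|A\<^sub>0| = |B\<^sub>0|\<close>, and the later parameters, hence \<open>G\<^sub>1\<close> and \<open>H\<^sub>1\<close>,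
  differ by a rotation; in each case \<open>A\<^sub>0 G\<^sub>1 = B\<^sub>0 H\<^sub>1\<close> (\<open>schur_chain_eq_if_products_eq\<close>).

  The facts about orthogonal polynomials are obtained by running the Szego recursion with
  coefficients chosen for orthogonality to the constants: the outcome is orthogonal, and
  orthogonal families are unique because the support is infinite.
\<close>

section \<open>Taylor coefficients of bounded holomorphic functions\<close>

lemma fps_nth_norm_le_of_bounded_on_disc:
  assumes hol: "f holomorphic_on ball 0 1"
    and exp: "f has_fps_expansion F"
    and r: "0 < r" "r < 1"
    and bound: "\<And>z. norm z = r \<Longrightarrow> norm (f z) \<le> B"
  shows "norm (fps_nth F k) \<le> B / r ^ k"
proof -
  have sub: "cball 0 r \<subseteq> ball (0::complex) 1"
    using r by auto
  have "norm ((deriv ^^ k) f 0) \<le> fact k * B / r ^ k"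
  proof (rule Cauchy_inequality)
    show "f holomorphic_on ball 0 r"
      using hol by (rule holomorphic_on_subset) (use r in auto)
    show "continuous_on (cball 0 r) f"
      using holomorphic_on_imp_continuous_on[OF hol] sub by (rule continuous_on_subset)
  qed (use r bound in auto)
  then have "norm ((deriv ^^ k) f 0) / fact k \<le> (fact k * B / r ^ k) / fact k"
    by (rule divide_right_mono) simp
  then show ?thesis
    by (simp add: fps_nth_fps_expansion[OF exp] norm_divide)
qed

lemma fps_nth_norm_le_of_bounded:
  assumes "f holomorphic_on ball 0 1" "f has_fps_expansion F"
    and bound: "\<And>z. norm z < 1 \<Longrightarrow> norm (f z) \<le> B"
  shows "norm (fps_nth F k) \<le> B"
proof (rule tendsto_lowerbound)
  have "((\<lambda>r::real. B / r ^ k) \<longlongrightarrow> B / 1 ^ k) (at_left 1)"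
    by (intro tendsto_intros) auto
  then show "((\<lambda>r::real. B / r ^ k) \<longlongrightarrow> B) (at_left 1)"
    by simp
  have "eventually (\<lambda>r::real. r \<in> {0<..<1}) (at_left 1)"
    by (rule eventually_at_leftI[of 0]) auto
  then show "eventually (\<lambda>r. norm (fps_nth F k) \<le> B / r ^ k) (at_left 1)"
    by eventually_elim
       (rule fps_nth_norm_le_of_bounded_on_disc[OF assms(1,2)]; use bound in auto)
qed simp

text \<open>The quantitative content of Montel's theorem: for uniformly bounded holomorphic functions on
  the disc, locally uniform convergence is convergence of each Taylor coefficient.\<close>

lemma locally_uniform_limit_iff_fps_nth_tendsto:
  fixes h :: "nat \<Rightarrow> complex \<Rightarrow> complex"
  assumes hol: "\<And>n. h n holomorphic_on ball 0 1"
    and exp: "\<And>n. h n has_fps_expansion P n"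
    and bound: "\<And>n z. norm z < 1 \<Longrightarrow> norm (h n z) \<le> B"
  shows "(\<forall>K. compact K \<and> K \<subseteq> ball 0 1 \<longrightarrow> uniform_limit K h (\<lambda>_. 0) sequentially)
     \<longleftrightarrow> (\<forall>k. (\<lambda>n. fps_nth (P n) k) \<longlonglongrightarrow> 0)" (is "?L \<longleftrightarrow> ?R")
proof
  assume L: ?L
  show ?R
  proof
    fix k
    have "uniform_limit (cball 0 (1/2)) h (\<lambda>_. 0) sequentially"
      using L[rule_format, of "cball 0 (1/2)"] by (simp add: cball_subset_ball_iff)
    then have unif: "\<forall>\<^sub>F n in sequentially. \<forall>z\<in>cball 0 (1/2). norm (h n z) < e" if "e > 0" for e
      using that by (auto simp: uniform_limit_iff)
    show "(\<lambda>n. fps_nth (P n) k) \<longlonglongrightarrow> 0"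
    proof (rule tendstoI)
      fix e :: real
      assume e: "e > 0"
      then have "e / 2 / 2 ^ k > 0"
        by simp
      from unif[OF this] show "\<forall>\<^sub>F n in sequentially. dist (fps_nth (P n) k) 0 < e"
      proof eventually_elim
        case (elim n)
        have "norm (fps_nth (P n) k) \<le> (e / 2 / 2 ^ k) / (1 / 2) ^ k"
          by (rule fps_nth_norm_le_of_bounded_on_disc[OF hol exp])
             (use elim in \<open>auto intro: less_imp_le\<close>)
        also have "\<dots> = e / 2"
          by (simp add: field_simps)
        also have "\<dots> < e"
          using e by simp
        finally show ?case
          by simp
      qed
    qed
  qed
next
  assume R: ?R
  have coeff_bound: "norm (fps_nth (P n) k) \<le> B" for n k
    by (rule fps_nth_norm_le_of_bounded[OF hol exp bound])
  show ?L
  proof (intro allI impI)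
    fix K :: "complex set"
    assume K: "compact K \<and> K \<subseteq> ball 0 1"
    obtain r where r: "0 \<le> r" "r < 1" "\<And>z. z \<in> K \<Longrightarrow> norm z \<le> r"
    proof (cases "K = {}")
      case True
      then show ?thesis
        using that[of 0] by simp
    next
      case False
      have "continuous_on K (norm :: complex \<Rightarrow> real)"
        by (intro continuous_intros)
      then obtain x where "x \<in> K" "\<forall>y\<in>K. norm y \<le> norm x"
        using continuous_attains_sup[of K norm] K False by auto
      then show ?thesis
        using that[of "norm x"] K by auto
    qed
    have geom: "summable (\<lambda>k. B * r ^ k)"
      using r by (intro summable_mult summable_geometric) simp
    have le: "norm (norm (fps_nth (P n) k) * r ^ k) \<le> B * r ^ k" for n k
      using r coeff_bound[of n k] by (simp add: mult_right_mono)
    define T where "T = (\<lambda>n. \<Sum>k. norm (fps_nth (P n) k) * r ^ k)"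
    have summ: "summable (\<lambda>k. norm (fps_nth (P n) k) * r ^ k)" for n
      using geom by (rule summable_comparison_test') (rule le)
    have "T \<longlonglongrightarrow> (\<Sum>k::nat. 0 * r ^ k)"
      unfolding T_def
    proof (rule tannerys_theorem[THEN conjunct2, THEN conjunct2])
      show "(\<lambda>n. norm (fps_nth (P n) k) * r ^ k) \<longlonglongrightarrow> 0 * r ^ k" for k
        using R by (intro tendsto_intros tendsto_norm_zero) auto
      show "\<forall>\<^sub>F (k, n) in sequentially \<times>\<^sub>F sequentially.
              norm (norm (fps_nth (P n) k) * r ^ k) \<le> B * r ^ k"
        using le by (intro always_eventually) auto
    qed (use geom in auto)
    then have T0: "T \<longlonglongrightarrow> 0"
      by simp
    have hT: "norm (h n z) \<le> T n" if "z \<in> K" for n z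
    proof -
      have z: "norm z \<le> r" "norm z < 1"
        using r that by force+
      have "(\<lambda>k. fps_nth (P n) k * z ^ k) sums h n z"
        by (rule has_fps_expansion_imp_sums_complex[where r = 1])
           (use exp hol z in \<open>auto simp: one_ereal_def\<close>)
      then have "norm (h n z) = norm (\<Sum>k. fps_nth (P n) k * z ^ k)"
        by (simp add: sums_iff)
      also have "\<dots> \<le> T n"
        unfolding T_def
        by (rule norm_suminf_le[OF _ summ])
           (use z in \<open>auto simp: norm_mult norm_power intro!: mult_left_mono power_mono\<close>)
      finally show ?thesis .
    qed
    show "uniform_limit K h (\<lambda>_. 0) sequentially"
      unfolding uniform_limit_iff
    proof (intro allI impI)
      fix e :: real
      assume "e > 0"
      with T0 have "\<forall>\<^sub>F n in sequentially. T n < e"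
        by (rule order_tendstoD)
      then show "\<forall>\<^sub>F n in sequentially. \<forall>z\<in>K. dist (h n z) 0 < e"
        by eventually_elim (use hT in \<open>auto intro: le_less_trans\<close>)
    qed
  qed
qed

section \<open>Subsequences\<close>

lemma tendsto_if_subseqs_have_tendsto_subseq:
  fixes x :: "nat \<Rightarrow> 'a::metric_space"
  assumes sub: "\<And>r :: nat \<Rightarrow> nat. strict_mono r \<Longrightarrow>
      \<exists>s :: nat \<Rightarrow> nat. strict_mono s \<and> (\<lambda>j. x (r (s j))) \<longlonglongrightarrow> l"
  shows "x \<longlonglongrightarrow> l"
proof (rule ccontr)
  assume "\<not> x \<longlonglongrightarrow> l"
  then obtain e where e: "e > 0" and "\<not> (\<forall>\<^sub>F n in sequentially. dist (x n) l < e)"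
    by (auto simp: tendsto_iff)
  then have inf: "infinite {n. \<not> dist (x n) l < e}"
    by (simp add: frequently_sequentially not_eventually flip: frequently_cofinite cofinite_eq_sequentially)
  define r where "r = enumerate {n. \<not> dist (x n) l < e}"
  have r: "strict_mono r" "\<And>j. \<not> dist (x (r j)) l < e"
    using strict_mono_enumerate[OF inf] enumerate_in_set[OF inf] by (auto simp: r_def)
  obtain s where "(\<lambda>j. x (r (s j))) \<longlonglongrightarrow> l"
    using sub[OF r(1)] by blast
  then have "\<forall>\<^sub>F j in sequentially. dist (x (r (s j))) l < e"
    using e by (rule tendstoD)
  then show False
    using r(2) by simp
qed

text \<open>Sequential compactness of a countable product of closed discs, in place of a diagonal
  argument.\<close>

lemma diagonal_convergent_subseq:
  fixes x :: "nat \<Rightarrow> 'i::countable \<Rightarrow> complex"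
  assumes bound: "\<And>n i. norm (x n i) \<le> B"
  obtains s :: "nat \<Rightarrow> nat" and L
  where "strict_mono s" "\<And>i. (\<lambda>j. x (s j) i) \<longlonglongrightarrow> L i"
proof -
  have "compactin (product_topology (\<lambda>_. euclidean) UNIV) (PiE UNIV (\<lambda>_::'i. cball (0::complex) B))"
    by (simp add: compactin_PiE)
  then have "compact (PiE UNIV (\<lambda>_::'i. cball (0::complex) B))"
    by (simp add: euclidean_product_topology)
  then have "seq_compact (PiE UNIV (\<lambda>_::'i. cball (0::complex) B))"
    by (rule compact_imp_seq_compact)
  moreover have "\<forall>n. x n \<in> PiE UNIV (\<lambda>_::'i. cball (0::complex) B)"
    using bound by auto
  ultimately obtain L s where s: "strict_mono s" "(x \<circ> s) \<longlonglongrightarrow> L"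
    unfolding seq_compact_def by blast
  have "(\<lambda>j. x (s j) i) \<longlonglongrightarrow> L i" for i
  proof -
    have "isCont (\<lambda>f :: 'i \<Rightarrow> complex. f i) L"
      by (rule continuous_on_interior[OF continuous_on_product_coordinates]) simp
    from isCont_tendsto_compose[OF this s(2)] show ?thesis
      by simp
  qed
  with s(1) show ?thesis
    by (rule that)
qed

section \<open>The Schur algorithm on formal power series\<close>

text \<open>One step of the inverse Schur algorithm at the level of Taylor series: \<open>G\<close> is the Moebius
  transform \<open>(z F - cnj a) / (1 - a z F)\<close> of \<open>z F\<close>, so that \<open>- cnj a\<close> is the first Schur
  parameter of \<open>G\<close> and the remaining ones are those of \<open>F\<close>. Clearing the denominator makes the
  relation polynomial in \<open>a\<close> and the coefficients, so that it survives coefficientwise limits.\<close>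

definition schur_step :: "complex \<Rightarrow> complex fps \<Rightarrow> complex fps \<Rightarrow> bool" where
  "schur_step a G F \<longleftrightarrow>
     G * (1 - fps_const a * (fps_X * F)) = fps_X * F - fps_const (cnj a)"

lemma schur_step_iff_fps_nth:
  "schur_step a G F \<longleftrightarrow>
     fps_nth G 0 = - cnj a \<and>
     (\<forall>k. fps_nth G (Suc k) =
            fps_nth F k + a * (\<Sum>i\<le>k. fps_nth G i * fps_nth F (k - i)))"
proof -
  define P where "P = G * F"
  have P: "fps_nth P k = (\<Sum>i\<le>k. fps_nth G i * fps_nth F (k - i))" for k
    by (simp add: P_def fps_mult_nth atMost_atLeast0)
  have "G * (1 - fps_const a * (fps_X * F)) = G - fps_X * (fps_const a * P)"
    by (simp add: P_def algebra_simps)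
  then have "schur_step a G F \<longleftrightarrow> G = fps_X * (F + fps_const a * P) - fps_const (cnj a)"
    unfolding schur_step_def by (auto simp: algebra_simps)
  also have "\<dots> \<longleftrightarrow>
      (\<forall>k. fps_nth G k = fps_nth (fps_X * (F + fps_const a * P) - fps_const (cnj a)) k)"
    (is "_ \<longleftrightarrow> (\<forall>k. ?P k)")
    by (simp add: fps_eq_iff)
  also have "\<dots> \<longleftrightarrow> ?P 0 \<and> (\<forall>k. ?P (Suc k))"
    by (metis not0_implies_Suc)
  also have "\<dots> \<longleftrightarrow> fps_nth G 0 = - cnj a \<and>
      (\<forall>k. fps_nth G (Suc k) = fps_nth F k + a * fps_nth P k)"
    by (simp add: fps_mult_fps_X_commute del: fps_mult_fps_X_plus_1_nth)
  finally show ?thesis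
    by (simp only: P)
qed

lemma schur_step_nth_0: "schur_step a G F \<Longrightarrow> fps_nth G 0 = - cnj a"
  by (simp add: schur_step_iff_fps_nth)

lemma schur_step_nth_Suc:
  "schur_step a G F \<Longrightarrow>
     fps_nth G (Suc k) = fps_nth F k + a * (\<Sum>i\<le>k. fps_nth G i * fps_nth F (k - i))"
  by (simp add: schur_step_iff_fps_nth)

lemma schur_step_tendsto:
  assumes step: "\<forall>\<^sub>F j in sequentially. schur_step (a j) (G j) (F j)"
    and a: "a \<longlonglongrightarrow> a'"
    and G: "\<And>k. (\<lambda>j. fps_nth (G j) k) \<longlonglongrightarrow> fps_nth G' k"
    and F: "\<And>k. (\<lambda>j. fps_nth (F j) k) \<longlonglongrightarrow> fps_nth F' k"
  shows "schur_step a' G' F'"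
  unfolding schur_step_iff_fps_nth
proof (intro conjI allI)
  have "(\<lambda>j. - cnj (a j)) \<longlonglongrightarrow> - cnj a'"
    using a by (intro tendsto_intros)
  moreover have "\<forall>\<^sub>F j in sequentially. - cnj (a j) = fps_nth (G j) 0"
    using step by eventually_elim (simp add: schur_step_nth_0)
  ultimately have "(\<lambda>j. fps_nth (G j) 0) \<longlonglongrightarrow> - cnj a'"
    by (rule Lim_transform_eventually)
  with G show "fps_nth G' 0 = - cnj a'"
    by (rule LIMSEQ_unique)
  fix k
  let ?R = "\<lambda>a F G. fps_nth F k + a * (\<Sum>i\<le>k. fps_nth G i * fps_nth F (k - i))"
  have "(\<lambda>j. ?R (a j) (F j) (G j)) \<longlonglongrightarrow> ?R a' F' G'"
    using a G F by (intro tendsto_intros)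
  moreover have "\<forall>\<^sub>F j in sequentially. ?R (a j) (F j) (G j) = fps_nth (G j) (Suc k)"
    using step by eventually_elim (simp add: schur_step_nth_Suc)
  ultimately have "(\<lambda>j. fps_nth (G j) (Suc k)) \<longlonglongrightarrow> ?R a' F' G'"
    by (rule Lim_transform_eventually)
  with G show "fps_nth G' (Suc k) = ?R a' F' G'"
    by (rule LIMSEQ_unique)
qed

text \<open>The linear relation \<open>c G = d H\<close> between two power series is inherited by their Schur iterates
  as soon as the products of Schur parameter and iterate agree.\<close>

lemma schur_step_proportional:
  assumes G: "schur_step a G F" and H: "schur_step b H K"
    and eq: "fps_const a * F = fps_const b * K"
    and cd: "fps_const c * G = fps_const d * H"
  shows "fps_const c * F = fps_const d * K"
proof -
  have XF: "fps_X * F = G * (1 - fps_X * (fps_const a * F)) - fps_const (fps_nth G 0)"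
    using G unfolding schur_step_nth_0[OF G] schur_step_def
    by (simp add: algebra_simps flip: fps_const_neg)
  have XK: "fps_X * K = H * (1 - fps_X * (fps_const b * K)) - fps_const (fps_nth H 0)"
    using H unfolding schur_step_nth_0[OF H] schur_step_def
    by (simp add: algebra_simps flip: fps_const_neg)
  have cd0: "fps_const (c * fps_nth G 0) = fps_const (d * fps_nth H 0)"
    using arg_cong[OF cd, of "\<lambda>f. fps_nth f 0"] by simp
  have "fps_X * (fps_const c * F) = fps_const c * (fps_X * F)"
    by (simp add: mult_ac)
  also have "\<dots> = (fps_const c * G) * (1 - fps_X * (fps_const a * F)) - fps_const (c * fps_nth G 0)"
    by (subst XF) (simp add: right_diff_distrib mult.assoc)
  also have "\<dots> = (fps_const d * H) * (1 - fps_X * (fps_const b * K)) - fps_const (d * fps_nth H 0)"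
    by (simp only: cd cd0 eq)
  also have "\<dots> = fps_const d * (fps_X * K)"
    by (subst XK) (simp add: right_diff_distrib mult.assoc)
  also have "\<dots> = fps_X * (fps_const d * K)"
    by (simp add: mult_ac)
  finally show ?thesis
    by simp
qed

text \<open>Two infinite Schur chains with equal products of parameter and following iterate have equal
  products of parameters: the relation \<open>A\<^sub>0 G\<^sub>1 = B\<^sub>0 H\<^sub>1\<close> propagates to \<open>A\<^sub>0 G\<^sub>l = B\<^sub>0 H\<^sub>l\<close>, whose
  constant terms are the claim. No division by \<open>A\<^sub>0\<close> or \<open>B\<^sub>0\<close> is needed.\<close>

lemma schur_chain_products_eq:
  assumes G: "\<And>m. schur_step (A m) (G m) (G (Suc m))"
    and H: "\<And>m. schur_step (B m) (H m) (H (Suc m))"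
    and eq: "\<And>m. fps_const (A m) * G (Suc m) = fps_const (B m) * H (Suc m)"
    and "l \<ge> 1"
  shows "A 0 * cnj (A l) = B 0 * cnj (B l)"
proof -
  have "fps_const (A 0) * G (Suc m) = fps_const (B 0) * H (Suc m)" for m
  proof (induction m)
    case 0
    show ?case by (rule eq)
  next
    case (Suc m)
    show ?case
      by (rule schur_step_proportional[OF G H eq Suc])
  qed
  from arg_cong[OF this[of "l - 1"], of "\<lambda>f. fps_nth f 0"] show ?thesis
    using \<open>l \<ge> 1\<close> schur_step_nth_0[OF G, of l] schur_step_nth_0[OF H, of l] by simp
qed

text \<open>If at most one parameter is nonzero, then no product of two parameters enters the Taylor
  coefficients.\<close>

lemma schur_chain_nth_single_parameter:
  assumes G: "\<And>m. schur_step (A m) (G m) (G (Suc m))"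
    and single: "\<And>p q. p < q \<Longrightarrow> A p = 0 \<or> A q = 0"
  shows "fps_nth (G m) k = - cnj (A (m + k))"
proof (induction k arbitrary: m rule: less_induct)
  case (less k)
  show ?case
  proof (cases k)
    case 0
    then show ?thesis
      by (simp add: schur_step_nth_0[OF G])
  next
    case (Suc k')
    have "A m * (\<Sum>i\<le>k'. fps_nth (G m) i * fps_nth (G (Suc m)) (k' - i)) = 0"
    proof (cases "A m = 0")
      case False
      have "fps_nth (G (Suc m)) (k' - i) = 0" for i
        using less.IH[of "k' - i" "Suc m"] Suc single[of m "Suc m + (k' - i)"] False by auto
      then show ?thesis
        by simp
    qed simp
    then show ?thesis
      using schur_step_nth_Suc[OF G, of m k'] less.IH[of k' "Suc m"] Suc by simp
  qed
qed

text \<open>Rotating all parameters by a unimodular constant rotates the Schur function.\<close>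

lemma schur_chain_nth_rotate:
  assumes G: "\<And>m. schur_step (A m) (G m) (G (Suc m))"
    and H: "\<And>m. schur_step (B m) (H m) (H (Suc m))"
    and rot: "\<And>m. B m = \<omega> * A m" and \<omega>: "\<omega> * cnj \<omega> = 1"
  shows "fps_nth (H m) k = cnj \<omega> * fps_nth (G m) k"
proof (induction k arbitrary: m rule: less_induct)
  case (less k)
  show ?case
  proof (cases k)
    case 0
    then show ?thesis
      by (simp add: schur_step_nth_0[OF G] schur_step_nth_0[OF H] rot)
  next
    case (Suc k')
    have "B m * (\<Sum>i\<le>k'. fps_nth (H m) i * fps_nth (H (Suc m)) (k' - i)) =
        \<omega> * A m * (\<Sum>i\<le>k'. (cnj \<omega> * fps_nth (G m) i) * (cnj \<omega> * fps_nth (G (Suc m)) (k' - i)))"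
      unfolding rot
      by (intro arg_cong2[where f = "(*)"] refl sum.cong) (auto simp: less.IH Suc)
    also have "\<dots> = (\<omega> * cnj \<omega>) * cnj \<omega> *
        (A m * (\<Sum>i\<le>k'. fps_nth (G m) i * fps_nth (G (Suc m)) (k' - i)))"
      by (simp add: sum_distrib_left mult_ac)
    finally show ?thesis
      using less.IH[of k' "Suc m"] Suc
      by (simp add: schur_step_nth_Suc[OF G] schur_step_nth_Suc[OF H] \<omega> distrib_left)
  qed
qed

text \<open>The converse. The moduli of the two parameter sequences may differ, but only if at most two
  parameters of each are nonzero; then \<open>A\<^sub>0 G\<^sub>1\<close> has at most one nonzero coefficient, which is minus a
  product \<open>A\<^sub>0 cnj A\<^sub>q\<close>. Otherwise the sequences differ by a rotation.\<close>

lemma schur_chain_eq_if_products_eq: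
  assumes G: "\<And>m. schur_step (A m) (G m) (G (Suc m))"
    and H: "\<And>m. schur_step (B m) (H m) (H (Suc m))"
    and eq: "\<And>p q. p < q \<Longrightarrow> A p * cnj (A q) = B p * cnj (B q)"
  shows "A 0 * fps_nth (G 1) k = B 0 * fps_nth (H 1) k"
proof -
  have zero_iff: "A p = 0 \<or> A q = 0 \<longleftrightarrow> B p = 0 \<or> B q = 0" if "p < q" for p q
    using eq[OF that] by (metis complex_cnj_zero_iff mult_eq_0_iff)
  show ?thesis
  proof (cases "\<forall>p q. 0 < p \<and> p < q \<longrightarrow> A p = 0 \<or> A q = 0")
    case True
    have "fps_nth (G (Suc 0)) k = - cnj (A (Suc (0 + k)))"
      by (rule schur_chain_nth_single_parameter[of "\<lambda>m. A (Suc m)" "\<lambda>m. G (Suc m)"])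
         (use G True in auto)
    moreover have "fps_nth (H (Suc 0)) k = - cnj (B (Suc (0 + k)))"
      by (rule schur_chain_nth_single_parameter[of "\<lambda>m. B (Suc m)" "\<lambda>m. H (Suc m)"])
         (use H True zero_iff in auto)
    ultimately show ?thesis
      using eq[of 0 "Suc k"] by simp
  next
    case False
    then obtain p q where pq: "0 < p" "p < q" and A: "A p \<noteq> 0" "A q \<noteq> 0"
      by auto
    with zero_iff[OF pq(2)] have B: "B p \<noteq> 0" "B q \<noteq> 0"
      by auto
    show ?thesis
    proof (cases "A 0 = 0 \<or> B 0 = 0")
      case True
      with zero_iff[OF pq(1)] A B show ?thesis
        by auto
    next
      case False
      \<comment> \<open>Three nonzero parameters determine the modulus of each of them.\<close>
      have "norm (A 0 * cnj (A p)) = norm (B 0 * cnj (B p))"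
        "norm (A 0 * cnj (A q)) = norm (B 0 * cnj (B q))"
        "norm (A p * cnj (A q)) = norm (B p * cnj (B q))"
        using eq[of 0 p] eq[of 0 q] eq[of p q] pq by simp_all
      then have norms: "norm (A 0) * norm (A p) = norm (B 0) * norm (B p)"
        "norm (A 0) * norm (A q) = norm (B 0) * norm (B q)"
        "norm (A p) * norm (A q) = norm (B p) * norm (B q)"
        by (simp_all add: norm_mult)
      have "(norm (A 0))\<^sup>2 * (norm (A p) * norm (A q)) =
          (norm (A 0) * norm (A p)) * (norm (A 0) * norm (A q))"
        by (simp add: power2_eq_square)
      also have "\<dots> = (norm (B 0))\<^sup>2 * (norm (B p) * norm (B q))"
        unfolding norms(1,2) by (simp add: power2_eq_square)
      also have "\<dots> = (norm (B 0))\<^sup>2 * (norm (A p) * norm (A q))"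
        by (simp only: norms(3))
      finally have "(norm (A 0))\<^sup>2 * (norm (A p) * norm (A q)) =
          (norm (B 0))\<^sup>2 * (norm (A p) * norm (A q))" .
      then have norm_eq: "norm (A 0) = norm (B 0)"
        using A by simp
      define \<omega> where "\<omega> = cnj (A 0 / B 0)"
      have "norm \<omega> = 1"
        using norm_eq False by (simp add: \<omega>_def norm_divide)
      then have \<omega>: "\<omega> * cnj \<omega> = 1"
        using complex_norm_square[of \<omega>] by simp
      have rot: "B (Suc m) = \<omega> * A (Suc m)" for m
      proof -
        have "cnj (B 0 * cnj (B (Suc m))) = cnj (A 0 * cnj (A (Suc m)))"
          using eq[of 0 "Suc m"] by simp
        then show ?thesis
          using False by (simp add: \<omega>_def field_simps)
      qed
      have "fps_nth (H (Suc 0)) k = cnj \<omega> * fps_nth (G (Suc 0)) k"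
        by (rule schur_chain_nth_rotate[of "\<lambda>m. A (Suc m)" "\<lambda>m. G (Suc m)" "\<lambda>m. B (Suc m)" "\<lambda>m. H (Suc m)"])
           (rule G H rot \<omega>)+
      then show ?thesis
        using False by (simp add: \<omega>_def)
    qed
  qed
qed

section \<open>Right limits\<close>

text \<open>A Schur flow is a sequence in which \<open>F (n + 1)\<close> arises from \<open>F n\<close> by a step with parameter
  \<open>a n\<close>; a Schur chain is indexed the other way, with \<open>G m\<close> arising from \<open>G (m + 1)\<close>. Read
  backwards from the index \<open>n\<close>, a bounded flow converges coefficientwise, along a subsequence of
  any given sequence of indices \<open>n\<close>, to an infinite chain. The subsequence is chosen for two flows
  simultaneously. Truncated subtraction affects only finitely many terms for each fixed shift
  \<open>m\<close>.\<close>

lemma schur_flow_right_limits: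
  assumes F: "\<And>n. schur_step (a n) (F (Suc n)) (F n)" "\<And>n k. norm (fps_nth (F n) k) \<le> 1"
    and K: "\<And>n. schur_step (b n) (K (Suc n)) (K n)" "\<And>n k. norm (fps_nth (K n) k) \<le> 1"
    and r: "strict_mono (r :: nat \<Rightarrow> nat)"
  shows "\<exists>s A G B H. strict_mono s \<and>
    (\<forall>m. filterlim (\<lambda>j. r (s j) - m) at_top sequentially) \<and>
    (\<forall>m. schur_step (A m) (G m) (G (Suc m))) \<and> (\<forall>m. schur_step (B m) (H m) (H (Suc m))) \<and>
    (\<forall>m. (\<lambda>j. a (r (s j) - m)) \<longlonglongrightarrow> A m) \<and> (\<forall>m. (\<lambda>j. b (r (s j) - m)) \<longlonglongrightarrow> B m) \<and>
    (\<forall>m k. (\<lambda>j. fps_nth (F (r (s j) - m)) k) \<longlonglongrightarrow> fps_nth (G (Suc m)) k) \<and>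
    (\<forall>m k. (\<lambda>j. fps_nth (K (r (s j) - m)) k) \<longlonglongrightarrow> fps_nth (H (Suc m)) k)"
proof -
  \<comment> \<open>Only coefficients need to converge: the parameters are their constant terms. The Boolean
    component selects one of the two flows.\<close>
  define x where "x = (\<lambda>n (i, m, k). fps_nth ((if i then F else K) (Suc (r n) - m)) k)"
  have "norm (x n i) \<le> 1" for n i
    using F(2) K(2) by (cases i) (auto simp: x_def)
  then obtain s L where s: "strict_mono s" and L: "\<And>i. (\<lambda>j. x (s j) i) \<longlonglongrightarrow> L i"
    using diagonal_convergent_subseq[of x 1] by blast
  define G where "G = (\<lambda>m. Abs_fps (\<lambda>k. L (True, m, k)))"
  define H where "H = (\<lambda>m. Abs_fps (\<lambda>k. L (False, m, k)))"
  have G: "(\<lambda>j. fps_nth (F (Suc (r (s j)) - m)) k) \<longlonglongrightarrow> fps_nth (G m) k" for m k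
    using L[of "(True, m, k)"] by (simp add: x_def G_def)
  have H: "(\<lambda>j. fps_nth (K (Suc (r (s j)) - m)) k) \<longlonglongrightarrow> fps_nth (H m) k" for m k
    using L[of "(False, m, k)"] by (simp add: x_def H_def)
  have "strict_mono (\<lambda>j. r (s j))"
    using strict_mono_o[OF r s] by (simp add: o_def)
  then have lim: "filterlim (\<lambda>j. r (s j)) at_top sequentially"
    by (rule filterlim_subseq)
  then have large: "\<forall>\<^sub>F j in sequentially. m \<le> r (s j)" for m
    by (rule filterlim_at_top[THEN iffD1, rule_format])
  from lim have shift: "filterlim (\<lambda>j. r (s j) - m) at_top sequentially" for m
    by (rule filterlim_compose[OF filterlim_minus_const_nat_at_top])
  have param: "(\<lambda>j. a (r (s j) - m)) \<longlonglongrightarrow> - cnj (fps_nth (G m) 0)"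
    if a: "\<And>n. schur_step (a n) (F (Suc n)) (F n)"
      and G: "\<And>m k. (\<lambda>j. fps_nth (F (Suc (r (s j)) - m)) k) \<longlonglongrightarrow> fps_nth (G m) k"
    for a F G m
  proof (rule Lim_transform_eventually)
    show "(\<lambda>j. - cnj (fps_nth (F (Suc (r (s j)) - m)) 0)) \<longlonglongrightarrow> - cnj (fps_nth (G m) 0)"
      by (intro tendsto_intros G)
    show "\<forall>\<^sub>F j in sequentially. - cnj (fps_nth (F (Suc (r (s j)) - m)) 0) = a (r (s j) - m)"
      using large[of m]
      by eventually_elim (simp add: Suc_diff_le schur_step_nth_0[OF a])
  qed
  have step: "schur_step (- cnj (fps_nth (G m) 0)) (G m) (G (Suc m))"
    if a: "\<And>n. schur_step (a n) (F (Suc n)) (F n)"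
      and G: "\<And>m k. (\<lambda>j. fps_nth (F (Suc (r (s j)) - m)) k) \<longlonglongrightarrow> fps_nth (G m) k"
    for a F G m
  proof (rule schur_step_tendsto)
    show "\<forall>\<^sub>F j in sequentially.
        schur_step (a (r (s j) - m)) (F (Suc (r (s j)) - m)) (F (Suc (r (s j)) - Suc m))"
      using large[of m] by eventually_elim (simp add: Suc_diff_le a)
  qed (rule param[of a F G, OF a G] G)+
  show ?thesis
  proof (intro exI conjI allI)
    show "strict_mono s" "filterlim (\<lambda>j. r (s j) - m) at_top sequentially" for m
      by (fact s shift)+
    show "schur_step (- cnj (fps_nth (G m) 0)) (G m) (G (Suc m))"
      "(\<lambda>j. a (r (s j) - m)) \<longlonglongrightarrow> - cnj (fps_nth (G m) 0)" for m
      by (rule step[of a F G, OF F(1) G] param[of a F G, OF F(1) G])+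
    show "schur_step (- cnj (fps_nth (H m) 0)) (H m) (H (Suc m))"
      "(\<lambda>j. b (r (s j) - m)) \<longlonglongrightarrow> - cnj (fps_nth (H m) 0)" for m
      by (rule step[of b K H, OF K(1) H] param[of b K H, OF K(1) H])+
    show "(\<lambda>j. fps_nth (F (r (s j) - m)) k) \<longlonglongrightarrow> fps_nth (G (Suc m)) k"
      "(\<lambda>j. fps_nth (K (r (s j) - m)) k) \<longlonglongrightarrow> fps_nth (H (Suc m)) k" for m k
      using G[of "Suc m" k] H[of "Suc m" k] by simp_all
  qed
qed

text \<open>Passing to right limits along arbitrary subsequences turns both asymptotic conditions into
  the exact identities between Schur chains compared above.\<close>

lemma schur_flow_tendsto_iff_products_tendsto:
  assumes F: "\<And>n. schur_step (a n) (F (Suc n)) (F n)" "\<And>n k. norm (fps_nth (F n) k) \<le> 1"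
    and K: "\<And>n. schur_step (b n) (K (Suc n)) (K n)" "\<And>n k. norm (fps_nth (K n) k) \<le> 1"
  shows "(\<forall>k. (\<lambda>n. a n * fps_nth (F n) k - b n * fps_nth (K n) k) \<longlonglongrightarrow> 0) \<longleftrightarrow>
         (\<forall>l\<ge>1. (\<lambda>n. a n * cnj (a (n - l)) - b n * cnj (b (n - l))) \<longlonglongrightarrow> 0)"
    (is "(\<forall>k. ?D k \<longlonglongrightarrow> 0) \<longleftrightarrow> (\<forall>l\<ge>1. ?E l \<longlonglongrightarrow> 0)")
proof
  assume D: "\<forall>k. ?D k \<longlonglongrightarrow> 0"
  show "\<forall>l\<ge>1. ?E l \<longlonglongrightarrow> 0"
  proof (intro allI impI tendsto_if_subseqs_have_tendsto_subseq)
    fix l :: nat and r :: "nat \<Rightarrow> nat"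
    assume l: "l \<ge> 1" and r: "strict_mono r"
    obtain s A G B H where s: "strict_mono s"
      and lims: "\<forall>m. filterlim (\<lambda>j. r (s j) - m) at_top sequentially"
        "\<forall>m. schur_step (A m) (G m) (G (Suc m))" "\<forall>m. schur_step (B m) (H m) (H (Suc m))"
        "\<forall>m. (\<lambda>j. a (r (s j) - m)) \<longlonglongrightarrow> A m" "\<forall>m. (\<lambda>j. b (r (s j) - m)) \<longlonglongrightarrow> B m"
        "\<forall>m k. (\<lambda>j. fps_nth (F (r (s j) - m)) k) \<longlonglongrightarrow> fps_nth (G (Suc m)) k"
        "\<forall>m k. (\<lambda>j. fps_nth (K (r (s j) - m)) k) \<longlonglongrightarrow> fps_nth (H (Suc m)) k"
      using schur_flow_right_limits[of a F b K r, OF F K r]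
      by (elim exE conjE) (rule that, assumption+)
    note shift = lims(1)[rule_format] and G = lims(2)[rule_format] and H = lims(3)[rule_format]
      and A = lims(4)[rule_format] and B = lims(5)[rule_format]
      and FG = lims(6)[rule_format] and KH = lims(7)[rule_format]
    have "A m * fps_nth (G (Suc m)) k = B m * fps_nth (H (Suc m)) k" for m k
    proof -
      have "(\<lambda>j. ?D k (r (s j) - m)) \<longlonglongrightarrow>
          A m * fps_nth (G (Suc m)) k - B m * fps_nth (H (Suc m)) k"
        by (intro tendsto_intros A B FG KH)
      moreover have "(\<lambda>j. ?D k (r (s j) - m)) \<longlonglongrightarrow> 0"
        by (rule filterlim_compose[OF _ shift]) (use D in simp)
      ultimately show ?thesis
        using LIMSEQ_unique by fastforce
    qed
    then have "A 0 * cnj (A l) = B 0 * cnj (B l)"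
      by (intro schur_chain_products_eq[of A G B H l] G H l) (simp add: fps_eq_iff)
    moreover have "(\<lambda>j. ?E l (r (s j))) \<longlonglongrightarrow> A 0 * cnj (A l) - B 0 * cnj (B l)"
      using A[of 0] B[of 0] by (intro tendsto_intros A B) auto
    ultimately show "\<exists>s. strict_mono s \<and> (\<lambda>j. ?E l (r (s j))) \<longlonglongrightarrow> 0"
      using s by auto
  qed
next
  assume E: "\<forall>l\<ge>1. ?E l \<longlonglongrightarrow> 0"
  show "\<forall>k. ?D k \<longlonglongrightarrow> 0"
  proof (intro allI tendsto_if_subseqs_have_tendsto_subseq)
    fix k :: nat and r :: "nat \<Rightarrow> nat"
    assume r: "strict_mono r"
    obtain s A G B H where s: "strict_mono s"
      and lims: "\<forall>m. filterlim (\<lambda>j. r (s j) - m) at_top sequentially"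
        "\<forall>m. schur_step (A m) (G m) (G (Suc m))" "\<forall>m. schur_step (B m) (H m) (H (Suc m))"
        "\<forall>m. (\<lambda>j. a (r (s j) - m)) \<longlonglongrightarrow> A m" "\<forall>m. (\<lambda>j. b (r (s j) - m)) \<longlonglongrightarrow> B m"
        "\<forall>m k. (\<lambda>j. fps_nth (F (r (s j) - m)) k) \<longlonglongrightarrow> fps_nth (G (Suc m)) k"
        "\<forall>m k. (\<lambda>j. fps_nth (K (r (s j) - m)) k) \<longlonglongrightarrow> fps_nth (H (Suc m)) k"
      using schur_flow_right_limits[of a F b K r, OF F K r]
      by (elim exE conjE) (rule that, assumption+)
    note shift = lims(1)[rule_format] and G = lims(2)[rule_format] and H = lims(3)[rule_format]
      and A = lims(4)[rule_format] and B = lims(5)[rule_format]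
      and FG = lims(6)[rule_format] and KH = lims(7)[rule_format]
    have "A p * cnj (A q) = B p * cnj (B q)" if "p < q" for p q
    proof -
      have "(\<lambda>j. ?E (q - p) (r (s j) - p)) \<longlonglongrightarrow> A p * cnj (A q) - B p * cnj (B q)"
        using A[of q] B[of q] that by (intro tendsto_intros A B) auto
      moreover have "(\<lambda>j. ?E (q - p) (r (s j) - p)) \<longlonglongrightarrow> 0"
        by (rule filterlim_compose[OF _ shift]) (use E[rule_format, of "q - p"] that in simp)
      ultimately show ?thesis
        using LIMSEQ_unique by fastforce
    qed
    then have "A 0 * fps_nth (G 1) k = B 0 * fps_nth (H 1) k"
      by (rule schur_chain_eq_if_products_eq[of A G B H, OF G H])
    moreover have "(\<lambda>j. ?D k (r (s j))) \<longlonglongrightarrow> A 0 * fps_nth (G 1) k - B 0 * fps_nth (H 1) k"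
      using A[of 0] B[of 0] FG[of 0] KH[of 0] by (intro tendsto_intros) auto
    ultimately show "\<exists>s. strict_mono s \<and> (\<lambda>j. ?D k (r (s j))) \<longlonglongrightarrow> 0"
      using s by auto
  qed
qed

section \<open>Orthogonal polynomials on the unit circle\<close>

text \<open>The inner product of \<open>L\<^sup>2(M)\<close> on polynomials, conjugate-linear in the first argument.\<close>

definition poly_inner :: "complex measure \<Rightarrow> complex poly \<Rightarrow> complex poly \<Rightarrow> complex" where
  "poly_inner M p q = (LINT z|M. cnj (poly p z) * poly q z)"

lemma space_circle: "nontrivial_circle_prob M \<Longrightarrow> space M = sphere 0 1"
  using sets_eq_imp_space_eq[of M "restrict_space borel (sphere 0 1)"]
  by (simp add: nontrivial_circle_prob_def space_restrict_space)

lemma integrable_continuous_circle: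
  fixes f :: "complex \<Rightarrow> 'b::{banach, second_countable_topology}"
  assumes M: "nontrivial_circle_prob M" and f: "continuous_on (sphere 0 1) f"
  shows "integrable M f"
proof -
  interpret prob_space M
    using M by (simp add: nontrivial_circle_prob_def)
  have "f \<in> borel_measurable (restrict_space borel (sphere 0 1))"
    by (rule borel_measurable_continuous_on_restrict[OF f])
  moreover have "sets M = sets (restrict_space borel (sphere 0 1))"
    using M by (simp add: nontrivial_circle_prob_def)
  ultimately have meas: "f \<in> borel_measurable M"
    using measurable_cong_sets by blast
  have "bounded (f ` sphere 0 1)"
    by (intro compact_imp_bounded compact_continuous_image f) simp
  then obtain B where "\<forall>z\<in>sphere 0 1. norm (f z) \<le> B"
    by (auto simp: bounded_iff)
  then have "AE z in M. norm (f z) \<le> B"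
    by (intro AE_I2) (simp add: space_circle[OF M])
  then show ?thesis
    using meas by (rule integrable_const_bound)
qed

lemma integrable_poly_inner:
  "nontrivial_circle_prob M \<Longrightarrow> integrable M (\<lambda>z. cnj (poly p z) * poly q z)"
  by (rule integrable_continuous_circle) (auto intro!: continuous_intros)

lemma poly_inner_commute: "poly_inner M q p = cnj (poly_inner M p q)"
proof -
  have "poly_inner M q p = (LINT z|M. cnj (cnj (poly p z) * poly q z))"
    unfolding poly_inner_def by (simp only: complex_cnj_mult complex_cnj_cnj mult.commute)
  also have "\<dots> = cnj (poly_inner M p q)"
    unfolding poly_inner_def by (rule Bochner_Integration.integral_cnj)
  finally show ?thesis .
qed

lemma poly_inner_diff_right:
  assumes "nontrivial_circle_prob M"
  shows "poly_inner M p (q - r) = poly_inner M p q - poly_inner M p r"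
  by (simp add: poly_inner_def right_diff_distrib integrable_poly_inner[OF assms])

lemma poly_inner_smult_right: "poly_inner M p (smult c q) = c * poly_inner M p q"
  by (simp add: poly_inner_def mult.left_commute)

lemma poly_inner_diff_left:
  assumes "nontrivial_circle_prob M"
  shows "poly_inner M (p - q) r = poly_inner M p r - poly_inner M q r"
  by (simp add: poly_inner_def left_diff_distrib integrable_poly_inner[OF assms])

lemma poly_inner_smult_left: "poly_inner M (smult c p) q = cnj c * poly_inner M p q"
  by (simp add: poly_inner_def mult.assoc)

lemma poly_inner_cong:
  assumes "nontrivial_circle_prob M"
    and "\<And>z. norm z = 1 \<Longrightarrow> cnj (poly p z) * poly q z = cnj (poly p' z) * poly q' z"
  shows "poly_inner M p q = poly_inner M p' q'"
  unfolding poly_inner_def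
  by (rule Bochner_Integration.integral_cong) (use assms space_circle in auto)

lemma cnj_mult_self_circle: "norm z = 1 \<Longrightarrow> cnj z * z = 1"
  using complex_norm_square[of z] by (simp add: mult.commute)

lemma poly_inner_pCons_pCons:
  assumes "nontrivial_circle_prob M"
  shows "poly_inner M (pCons 0 p) (pCons 0 q) = poly_inner M p q"
proof (rule poly_inner_cong[OF assms])
  fix z :: complex
  assume "norm z = 1"
  then have "cnj z * z = 1"
    by (rule cnj_mult_self_circle)
  moreover have "cnj (poly (pCons 0 p) z) * poly (pCons 0 q) z =
      (cnj z * z) * (cnj (poly p z) * poly q z)"
    by simp
  ultimately show "cnj (poly (pCons 0 p) z) * poly (pCons 0 q) z = cnj (poly p z) * poly q z"
    by simp
qed

lemma poly_reversed_poly_circle: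
  assumes "norm z = 1"
  shows "poly (reversed_poly p) z = z ^ degree p * cnj (poly p z)"
proof -
  have "z \<noteq> 0"
    using assms by auto
  moreover from this have "1 / cnj z = z"
    using cnj_mult_self_circle[OF assms] by (simp add: divide_eq_eq mult.commute)
  ultimately show ?thesis
    by (simp add: poly_reversed_poly)
qed

text \<open>Reversal is the antiunitary map \<open>p \<mapsto> z\<^sup>n cnj p\<close>.\<close>

lemma poly_inner_monom_reversed:
  assumes M: "nontrivial_circle_prob M" and k: "k \<le> degree p"
  shows "poly_inner M (monom 1 k) (reversed_poly p) = poly_inner M p (monom 1 (degree p - k))"
proof (rule poly_inner_cong[OF M])
  fix z :: complex
  assume z: "norm z = 1"
  have "cnj z ^ k * z ^ degree p = (cnj z * z) ^ k * z ^ (degree p - k)"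
    using k by (simp add: power_mult_distrib mult.assoc flip: power_add)
  then have "cnj z ^ k * z ^ degree p = z ^ (degree p - k)"
    using cnj_mult_self_circle[OF z] by simp
  then show "cnj (poly (monom 1 k) z) * poly (reversed_poly p) z =
      cnj (poly p z) * poly (monom 1 (degree p - k)) z"
    by (simp add: poly_monom poly_reversed_poly_circle[OF z] mult_ac)
qed

lemma poly_inner_reversed_reversed:
  assumes M: "nontrivial_circle_prob M"
  shows "poly_inner M (reversed_poly p) (reversed_poly p) = poly_inner M p p"
proof (rule poly_inner_cong[OF M])
  fix z :: complex
  assume z: "norm z = 1"
  have "cnj (poly (reversed_poly p) z) * poly (reversed_poly p) z =
      (cnj z * z) ^ degree p * (cnj (poly p z) * poly p z)"
    by (simp add: poly_reversed_poly_circle[OF z] power_mult_distrib mult_ac)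
  then show "cnj (poly (reversed_poly p) z) * poly (reversed_poly p) z = cnj (poly p z) * poly p z"
    using cnj_mult_self_circle[OF z] by simp
qed

lemma poly_inner_self:
  assumes M: "nontrivial_circle_prob M"
  shows "poly_inner M p p = of_real (LINT z|M. (norm (poly p z))\<^sup>2)"
proof -
  have "poly_inner M p p = (LINT z|M. of_real ((norm (poly p z))\<^sup>2))"
    unfolding poly_inner_def by (simp only: complex_norm_square mult.commute)
  then show ?thesis
    by (simp only: integral_complex_of_real)
qed

text \<open>Definiteness is where the support being infinite enters: a polynomial of norm zero vanishes
  on the support.\<close>

lemma poly_inner_self_eq_0:
  assumes M: "nontrivial_circle_prob M" and zero: "poly_inner M p p = 0"
  shows "p = 0"
proof (rule ccontr)
  assume "p \<noteq> 0"
  have int: "integrable M (\<lambda>z. (norm (poly p z))\<^sup>2)"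
    by (rule integrable_continuous_circle[OF M]) (intro continuous_intros)
  have "(LINT z|M. (norm (poly p z))\<^sup>2) = 0"
    using zero poly_inner_self[OF M, of p] by simp
  then have ae: "AE z in M. poly p z = 0"
    using integral_nonneg_eq_0_iff_AE[OF int] by simp
  have "measure_support M \<subseteq> {z. poly p z = 0}"
  proof
    fix x
    assume x: "x \<in> measure_support M"
    show "x \<in> {z. poly p z = 0}"
    proof (rule ccontr)
      assume nz: "x \<notin> {z. poly p z = 0}"
      define U where "U = {z. poly p z \<noteq> 0}"
      have "open U"
        unfolding U_def by (intro open_Collect_neq continuous_intros)
      with x nz have pos: "emeasure M (U \<inter> space M) > 0"
        by (auto simp: measure_support_def U_def)
      moreover have "{z \<in> space M. \<not> poly p z = 0} = U \<inter> space M"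
        by (auto simp: U_def)
      then have "U \<inter> space M \<in> sets M"
        using emeasure_notin_sets[of "U \<inter> space M" M] pos by fastforce
      ultimately show False
        using AE_iff_measurable[of "U \<inter> space M" M "\<lambda>z. poly p z = 0"] ae
          \<open>{z \<in> space M. \<not> poly p z = 0} = U \<inter> space M\<close> by simp
    qed
  qed
  then have "finite (measure_support M)"
    using poly_roots_finite[OF \<open>p \<noteq> 0\<close>] by (rule finite_subset)
  then show False
    using M by (simp add: nontrivial_circle_prob_def)
qed

lemma poly_inner_self_pos:
  assumes M: "nontrivial_circle_prob M" and "p \<noteq> 0"
  obtains x where "poly_inner M p p = complex_of_real x" "x > 0"
proof -
  have "(LINT z|M. (norm (poly p z))\<^sup>2) \<ge> 0"
    by (rule integral_nonneg_AE) simp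
  moreover have "(LINT z|M. (norm (poly p z))\<^sup>2) \<noteq> 0"
    using poly_inner_self_eq_0[OF M, of p] poly_inner_self[OF M, of p] \<open>p \<noteq> 0\<close> by auto
  ultimately have "(LINT z|M. (norm (poly p z))\<^sup>2) > 0"
    by linarith
  then show ?thesis
    by (rule that[OF poly_inner_self[OF M]])
qed

text \<open>Polynomials \<open>Q\<^sub>k\<close> of degree exactly \<open>k\<close>, for \<open>k < n\<close>, span all polynomials of degree below
  \<open>n\<close>. The degree bound on \<open>q\<close> is stated through its coefficients, so that \<open>n = 0\<close> forces
  \<open>q = 0\<close>.\<close>

lemma orthogonal_to_lower_degree:
  assumes M: "nontrivial_circle_prob M"
    and Q: "\<And>k. k < n \<Longrightarrow> degree (Q k) = k" "\<And>k. k < n \<Longrightarrow> Q k \<noteq> 0"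
    and orth: "\<And>k. k < n \<Longrightarrow> poly_inner M (Q k) R = 0"
    and q: "\<And>k. k \<ge> n \<Longrightarrow> coeff q k = 0"
  shows "poly_inner M q R = 0"
  using assms(2-5)
proof (induction n arbitrary: q)
  case 0
  then have "q = 0"
    by (simp add: poly_eq_iff)
  then show ?case
    by (simp add: poly_inner_def)
next
  case (Suc n)
  define q' where "q' = q - smult (coeff q n / lead_coeff (Q n)) (Q n)"
  have "coeff q' k = 0" if "k \<ge> n" for k
  proof (cases "k = n")
    case True
    then show ?thesis
      using Suc.prems(1,2)[of n] leading_coeff_0_iff[of "Q n"] by (auto simp: q'_def)
  next
    case False
    then show ?thesis
      using that Suc.prems(1)[of n] Suc.prems(4)[of k] by (simp add: q'_def coeff_eq_0)
  qed
  then have "poly_inner M q' R = 0"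
    using Suc.prems(1-3) by - (rule Suc.IH, simp_all)
  then show ?case
    using Suc.prems(3)[of n]
    by (simp add: q'_def poly_inner_diff_left[OF M] poly_inner_smult_left)
qed

text \<open>The Szego recursion taken as a definition, with the coefficient chosen so that the new
  polynomial is orthogonal to the constants.\<close>

primrec szego_poly :: "complex measure \<Rightarrow> nat \<Rightarrow> complex poly" where
  "szego_poly M 0 = 1"
| "szego_poly M (Suc n) = pCons 0 (szego_poly M n)
     - smult (poly_inner M 1 (pCons 0 (szego_poly M n)) / poly_inner M 1 (reversed_poly (szego_poly M n)))
         (reversed_poly (szego_poly M n))"

lemma coeff_reversed_poly:
  "coeff (reversed_poly p) k = (if k \<le> degree p then cnj (coeff p (degree p - k)) else 0)"
  by (simp add: reversed_poly_def coeff_reflect_poly coeff_map_poly degree_map_poly)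

lemma szego_poly_monic_orthogonal:
  assumes M: "nontrivial_circle_prob M"
  shows "degree (szego_poly M n) = n \<and> lead_coeff (szego_poly M n) = 1 \<and>
         (\<forall>k<n. poly_inner M (monom 1 k) (szego_poly M n) = 0)"
proof (induction n)
  case 0
  show ?case by simp
next
  case (Suc n)
  let ?P = "szego_poly M n" and ?Q = "szego_poly M (Suc n)"
  have deg: "degree ?P = n" and lead: "coeff ?P n = 1"
    and orth: "\<And>k. k < n \<Longrightarrow> poly_inner M (monom 1 k) ?P = 0"
    using Suc.IH by auto
  have coeff_top: "coeff ?Q (Suc n) = 1"
    by (simp add: coeff_reversed_poly deg lead)
  have "degree ?Q \<le> Suc n"
    by (rule degree_le) (auto simp: coeff_reversed_poly deg coeff_pCons coeff_eq_0 split: nat.splits)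
  then have deg': "degree ?Q = Suc n"
    using le_degree[of ?Q "Suc n"] coeff_top by (simp only: le_antisym one_neq_zero not_False_eq_True)
  have "poly_inner M (monom 1 k) ?Q = 0" if k: "k < Suc n" for k
  proof (cases k)
    case 0
    have "poly_inner M ?P (?P - monom 1 n) = cnj (poly_inner M (?P - monom 1 n) ?P)"
      by (rule poly_inner_commute)
    also have "poly_inner M (?P - monom 1 n) ?P = 0"
    proof (rule orthogonal_to_lower_degree[OF M, of n "monom 1"])
      fix k assume "k \<ge> n"
      then show "coeff (?P - monom 1 n) k = 0"
        using deg lead by (cases "k = n") (auto simp: coeff_eq_0)
    qed (use orth in \<open>auto simp: degree_monom_eq monom_eq_0_iff\<close>)
    finally have "poly_inner M ?P (monom 1 n) = poly_inner M ?P ?P"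
      by (simp add: poly_inner_diff_right[OF M])
    moreover have "poly_inner M 1 (reversed_poly ?P) = poly_inner M ?P (monom 1 n)"
      using poly_inner_monom_reversed[OF M, of 0 ?P] deg by (simp add: monom_eq_1)
    moreover have "poly_inner M ?P ?P \<noteq> 0"
      using poly_inner_self_eq_0[OF M, of ?P] lead by auto
    ultimately show ?thesis
      using 0 by (simp add: monom_eq_1 poly_inner_diff_right[OF M] poly_inner_smult_right)
  next
    case (Suc k')
    have "poly_inner M (monom 1 k) (pCons 0 ?P) = 0"
      using poly_inner_pCons_pCons[OF M, of "monom 1 k'" ?P] orth[of k'] k Suc
      by (simp add: monom_Suc)
    moreover have "poly_inner M (monom 1 k) (reversed_poly ?P) = cnj (poly_inner M (monom 1 (n - k)) ?P)"
      using poly_inner_monom_reversed[OF M, of k ?P] deg k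
      by (simp add: poly_inner_commute[of M ?P])
    moreover have "poly_inner M (monom 1 (n - k)) ?P = 0"
      using orth[of "n - k"] k Suc by simp
    ultimately show ?thesis
      by (simp add: poly_inner_diff_right[OF M] poly_inner_smult_right)
  qed
  with deg' coeff_top show ?case
    by simp
qed

lemma szego_poly_orthogonal:
  assumes M: "nontrivial_circle_prob M" and q: "\<And>k. k \<ge> n \<Longrightarrow> coeff q k = 0"
  shows "poly_inner M q (szego_poly M n) = 0"
  by (rule orthogonal_to_lower_degree[OF M, of n "monom 1"])
     (use szego_poly_monic_orthogonal[OF M] q in \<open>auto simp: degree_monom_eq monom_eq_0_iff\<close>)

lemma is_monic_OPs_szego_poly:
  assumes M: "nontrivial_circle_prob M"
  shows "is_monic_OPs M (szego_poly M)"
proof -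
  note props = szego_poly_monic_orthogonal[OF M]
  have less: "poly_inner M (szego_poly M m) (szego_poly M n) = 0" if "m < n" for m n
    by (rule szego_poly_orthogonal[OF M]) (use props[of m] that in \<open>auto intro: coeff_eq_0\<close>)
  have "poly_inner M (szego_poly M m) (szego_poly M n) = 0" if "m \<noteq> n" for m n
    using less[of m n] less[of n m] that
    by (cases "m < n") (simp_all add: poly_inner_commute[of M "szego_poly M m"])
  moreover have "coeff (szego_poly M n) n = 1" for n
    using props[of n] by metis
  ultimately show ?thesis
    using props by (auto simp: is_monic_OPs_def simp flip: poly_inner_def)
qed

lemma is_monic_OPs_unique:
  assumes M: "nontrivial_circle_prob M" and P: "is_monic_OPs M P" and Q: "is_monic_OPs M Q"
  shows "P = Q"
proof
  fix n
  have nz: "P k \<noteq> 0" "Q k \<noteq> 0" for k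
    using P Q by (metis is_monic_OPs_def leading_coeff_0_iff zero_neq_one)+
  have coeff: "coeff (P n - Q n) k = 0" if "k \<ge> n" for k
  proof (cases "k = n")
    case True
    have "coeff (P n) n = 1" "coeff (Q n) n = 1"
      using P Q by (metis is_monic_OPs_def)+
    with True show ?thesis
      by simp
  next
    case False
    then show ?thesis
      using that P Q by (simp add: is_monic_OPs_def coeff_eq_0)
  qed
  have "poly_inner M (P n - Q n) (P n) = 0"
    by (rule orthogonal_to_lower_degree[OF M, of n P])
       (use P nz coeff in \<open>auto simp: is_monic_OPs_def poly_inner_def\<close>)
  moreover have "poly_inner M (P n - Q n) (Q n) = 0"
    by (rule orthogonal_to_lower_degree[OF M, of n Q])
       (use Q nz coeff in \<open>auto simp: is_monic_OPs_def poly_inner_def\<close>)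
  ultimately have "poly_inner M (P n - Q n) (P n - Q n) = 0"
    by (simp add: poly_inner_diff_right[OF M])
  then have "P n - Q n = 0"
    by (rule poly_inner_self_eq_0[OF M])
  then show "P n = Q n"
    by simp
qed

lemma monic_OP_eq_szego_poly:
  assumes M: "nontrivial_circle_prob M"
  shows "monic_OP M = szego_poly M"
  unfolding monic_OP_def
proof (rule the_equality)
  show "is_monic_OPs M (szego_poly M)"
    by (rule is_monic_OPs_szego_poly[OF M])
  then show "P = szego_poly M" if "is_monic_OPs M P" for P
    using that by (intro is_monic_OPs_unique[OF M])
qed

lemma monic_OP_0: "nontrivial_circle_prob M \<Longrightarrow> monic_OP M 0 = 1"
  by (simp add: monic_OP_eq_szego_poly)

lemma degree_monic_OP: "nontrivial_circle_prob M \<Longrightarrow> degree (monic_OP M n) = n"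
  using szego_poly_monic_orthogonal[of M n] by (metis monic_OP_eq_szego_poly)

lemma coeff_monic_OP: "nontrivial_circle_prob M \<Longrightarrow> coeff (monic_OP M n) n = 1"
  using szego_poly_monic_orthogonal[of M n] by (metis monic_OP_eq_szego_poly)

lemma poly_reversed_OP_0: "nontrivial_circle_prob M \<Longrightarrow> poly (reversed_OP M n) 0 = 1"
  by (simp add: poly_0_coeff_0 reversed_OP_def coeff_reversed_poly degree_monic_OP coeff_monic_OP)

lemma reversed_OP_0: "nontrivial_circle_prob M \<Longrightarrow> reversed_OP M 0 = 1"
  by (simp add: reversed_OP_def monic_OP_0 reversed_poly_def)

lemma monic_OP_Suc:
  assumes M: "nontrivial_circle_prob M"
  shows "monic_OP M (Suc n) =
     pCons 0 (monic_OP M n) - smult (cnj (verblunsky M (int n))) (reversed_OP M n)"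
proof -
  define c where "c = poly_inner M 1 (pCons 0 (monic_OP M n)) / poly_inner M 1 (reversed_OP M n)"
  have rec: "monic_OP M (Suc n) = pCons 0 (monic_OP M n) - smult c (reversed_OP M n)"
    by (simp add: c_def reversed_OP_def monic_OP_eq_szego_poly[OF M])
  have "verblunsky M (int n) =
      (THE a. monic_OP M (Suc n) = [:0, 1:] * monic_OP M n - smult (cnj a) (reversed_OP M n))"
    by (simp add: verblunsky_def)
  also have "\<dots> = cnj c"
  proof (rule the_equality)
    fix a
    assume "monic_OP M (Suc n) = [:0, 1:] * monic_OP M n - smult (cnj a) (reversed_OP M n)"
    from arg_cong[OF this, of "\<lambda>p. poly p 0"] have "cnj a = c"
      by (simp add: rec poly_reversed_OP_0[OF M])
    then show "a = cnj c"
      by auto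
  qed (simp add: rec)
  finally show ?thesis
    by (simp add: rec)
qed

lemma poly_reversed_OP_Suc:
  assumes M: "nontrivial_circle_prob M"
  shows "poly (reversed_OP M (Suc n)) z =
     poly (reversed_OP M n) z - verblunsky M (int n) * z * poly (monic_OP M n) z"
proof (cases "z = 0")
  case True
  then show ?thesis
    by (simp add: poly_reversed_OP_0[OF M])
next
  case False
  define w where "w = 1 / cnj z"
  have w: "w \<noteq> 0" "1 / cnj w = z" "cnj w = 1 / z"
    using False by (auto simp: w_def)
  have "poly (reversed_OP M n) w = w ^ n * cnj (poly (monic_OP M n) z)"
    using poly_reversed_poly[OF w(1), of "monic_OP M n"] w(2)
    by (simp add: reversed_OP_def degree_monic_OP[OF M])
  then have *: "cnj (poly (reversed_OP M n) w) = (1 / z) ^ n * poly (monic_OP M n) z"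
    by (simp add: w(3))
  have R: "poly (reversed_OP M m) z = z ^ m * cnj (poly (monic_OP M m) w)" for m
    using poly_reversed_poly[OF False, of "monic_OP M m"]
    by (simp add: reversed_OP_def degree_monic_OP[OF M] w_def)
  have "poly (reversed_OP M (Suc n)) z =
      z ^ Suc n * (cnj w * cnj (poly (monic_OP M n) w) -
        verblunsky M (int n) * cnj (poly (reversed_OP M n) w))"
    by (simp only: R) (simp add: monic_OP_Suc[OF M])
  also have "\<dots> = z ^ n * cnj (poly (monic_OP M n) w) -
      verblunsky M (int n) * z * poly (monic_OP M n) z"
    using False by (simp add: * w(3) field_simps)
  finally show ?thesis
    by (simp add: R)
qed

text \<open>Pythagoras in the Szego recursion gives \<open>\<parallel>\<Phi>\<^bsub>n+1\<^esub>\<parallel>\<^sup>2 = (1 - |\<alpha>\<^sub>n|\<^sup>2) \<parallel>\<Phi>\<^sub>n\<parallel>\<^sup>2\<close>.\<close>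

lemma norm_verblunsky_less_1:
  assumes M: "nontrivial_circle_prob M"
  shows "norm (verblunsky M (int n)) < 1"
proof -
  let ?P = "monic_OP M n" and ?Q = "monic_OP M (Suc n)" and ?R = "reversed_OP M n"
  define a where "a = verblunsky M (int n)"
  have nz: "monic_OP M k \<noteq> 0" for k
    using coeff_monic_OP[OF M, of k] by auto
  obtain x y where x: "poly_inner M ?P ?P = of_real x" "x > 0"
    and y: "poly_inner M ?Q ?Q = of_real y" "y > 0"
    using poly_inner_self_pos[OF M nz] by metis
  have orth: "poly_inner M ?R ?Q = 0"
    unfolding monic_OP_eq_szego_poly[OF M] reversed_OP_def
    by (rule szego_poly_orthogonal[OF M])
       (simp add: coeff_reversed_poly szego_poly_monic_orthogonal[OF M])
  then have orth': "poly_inner M ?Q ?R = 0"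
    by (simp add: poly_inner_commute[of M ?Q])
  have zP: "pCons 0 ?P = ?Q - smult (- cnj a) ?R"
    by (simp add: monic_OP_Suc[OF M] a_def)
  have "poly_inner M ?P ?P = poly_inner M (pCons 0 ?P) (pCons 0 ?P)"
    by (simp add: poly_inner_pCons_pCons[OF M])
  also have "\<dots> = poly_inner M ?Q ?Q + a * cnj a * poly_inner M ?R ?R"
    unfolding zP
    by (simp only: poly_inner_diff_right[OF M] poly_inner_diff_left[OF M] poly_inner_smult_right
        poly_inner_smult_left orth orth') simp
  also have "poly_inner M ?R ?R = poly_inner M ?P ?P"
    by (simp add: reversed_OP_def poly_inner_reversed_reversed[OF M])
  finally have "complex_of_real x = complex_of_real (y + (norm a)\<^sup>2 * x)"
    by (simp only: x y of_real_add of_real_mult complex_norm_square)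
  then have "x = y + (norm a)\<^sup>2 * x"
    by (simp only: of_real_eq_iff)
  then have "(norm a)\<^sup>2 * x < 1 * x"
    using y by simp
  then have "(norm a)\<^sup>2 < 1"
    using x(2) by (simp only: mult_less_cancel_right_pos)
  then show ?thesis
    using abs_square_less_1[of "norm a"] by (simp add: a_def)
qed

section \<open>The inverse Schur iterates of a measure\<close>

text \<open>The quotient of an orthogonal polynomial and its reversal, and its Taylor series at the
  origin.\<close>

definition schur_iterate :: "complex measure \<Rightarrow> nat \<Rightarrow> complex \<Rightarrow> complex" where
  "schur_iterate M n z = poly (monic_OP M n) z / poly (reversed_OP M n) z"

definition schur_iterate_fps :: "complex measure \<Rightarrow> nat \<Rightarrow> complex fps" where
  "schur_iterate_fps M n = fps_of_poly (monic_OP M n) / fps_of_poly (reversed_OP M n)"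

lemma norm_moebius_le_1:
  assumes a: "norm a < 1" and w: "norm w \<le> 1"
  shows "norm (w - cnj a) \<le> norm (1 - a * w)"
proof -
  have "complex_of_real ((norm (1 - a * w))\<^sup>2 - (norm (w - cnj a))\<^sup>2) =
      (1 - a * w) * cnj (1 - a * w) - (w - cnj a) * cnj (w - cnj a)"
    by (simp only: of_real_diff complex_norm_square)
  also have "\<dots> = (1 - a * cnj a) * (1 - w * cnj w)"
    by (simp add: algebra_simps)
  also have "\<dots> = complex_of_real ((1 - (norm a)\<^sup>2) * (1 - (norm w)\<^sup>2))"
    by (simp only: of_real_diff of_real_mult of_real_1 complex_norm_square)
  finally have "(norm (1 - a * w))\<^sup>2 - (norm (w - cnj a))\<^sup>2 = (1 - (norm a)\<^sup>2) * (1 - (norm w)\<^sup>2)"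
    by (simp only: of_real_eq_iff)
  moreover have "(norm a)\<^sup>2 \<le> 1" "(norm w)\<^sup>2 \<le> 1"
    using a w by (simp_all add: abs_square_le_1)
  then have "(1 - (norm a)\<^sup>2) * (1 - (norm w)\<^sup>2) \<ge> 0"
    by simp
  ultimately have "(norm (w - cnj a))\<^sup>2 \<le> (norm (1 - a * w))\<^sup>2"
    by linarith
  then show ?thesis
    by (rule power2_le_imp_le) simp
qed

text \<open>Each step of the Szego recursion is a Moebius transform preserving the disc, which gives at
  once that reversed polynomials have no zeros in the disc and that the iterates are bounded by
  one.\<close>

lemma schur_iterate_bound:
  assumes M: "nontrivial_circle_prob M" and z: "norm z < 1"
  shows "poly (reversed_OP M n) z \<noteq> 0 \<and> norm (schur_iterate M n z) \<le> 1"
proof (induction n)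
  case 0
  show ?case
    by (simp add: schur_iterate_def monic_OP_0[OF M] reversed_OP_0[OF M])
next
  case (Suc n)
  define a where "a = verblunsky M (int n)"
  define w where "w = z * schur_iterate M n z"
  let ?R = "poly (reversed_OP M n) z"
  have a: "norm a < 1"
    unfolding a_def by (rule norm_verblunsky_less_1[OF M])
  have w: "norm w \<le> 1"
    using Suc z by (simp add: w_def norm_mult mult_le_one)
  have wR: "z * poly (monic_OP M n) z = w * ?R"
    using Suc by (simp add: w_def schur_iterate_def)
  have "poly (reversed_OP M (Suc n)) z = ?R - a * (z * poly (monic_OP M n) z)"
    by (simp add: poly_reversed_OP_Suc[OF M] a_def)
  then have R': "poly (reversed_OP M (Suc n)) z = ?R * (1 - a * w)"
    unfolding wR by (simp add: algebra_simps)
  have "poly (monic_OP M (Suc n)) z = z * poly (monic_OP M n) z - cnj a * ?R"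
    by (simp add: monic_OP_Suc[OF M] a_def)
  then have P': "poly (monic_OP M (Suc n)) z = ?R * (w - cnj a)"
    unfolding wR by (simp add: algebra_simps)
  have "norm (a * w) \<le> norm a * 1"
    unfolding norm_mult using w by (rule mult_left_mono) simp
  with a have nz: "1 - a * w \<noteq> 0"
    by auto
  have "norm (schur_iterate M (Suc n) z) = norm (w - cnj a) / norm (1 - a * w)"
    using Suc unfolding schur_iterate_def R' P' by (simp add: norm_divide)
  also have "\<dots> \<le> 1"
    using norm_moebius_le_1[OF a w] nz by simp
  finally show ?case
    using Suc nz R' by simp
qed

lemma has_fps_expansion_schur_iterate:
  assumes M: "nontrivial_circle_prob M"
  shows "schur_iterate M n has_fps_expansion schur_iterate_fps M n"
proof -
  have poly: "(\<lambda>z. poly p z) has_fps_expansion fps_of_poly p" for p :: "complex poly"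
    by (auto simp: has_fps_expansion_def)
  have "(\<lambda>z. poly (monic_OP M n) z / poly (reversed_OP M n) z) has_fps_expansion
      fps_of_poly (monic_OP M n) / fps_of_poly (reversed_OP M n)"
    by (intro has_fps_expansion_divide' poly)
       (use poly_reversed_OP_0[OF M, of n] in \<open>simp add: poly_0_coeff_0\<close>)
  then show ?thesis
    by (simp add: schur_iterate_def[abs_def] schur_iterate_fps_def)
qed

lemma holomorphic_schur_iterate:
  assumes M: "nontrivial_circle_prob M"
  shows "schur_iterate M n holomorphic_on ball 0 1"
proof -
  have "(\<lambda>z. poly (monic_OP M n) z / poly (reversed_OP M n) z) holomorphic_on ball 0 1"
  proof (rule holomorphic_on_divide)
    show "poly (reversed_OP M n) z \<noteq> 0" if "z \<in> ball 0 1" for z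
      using schur_iterate_bound[OF M, of z n] that by simp
  qed (rule poly_holomorphic_on holomorphic_on_ident)+
  then show ?thesis
    unfolding schur_iterate_def[abs_def] .
qed

lemma norm_fps_nth_schur_iterate:
  assumes M: "nontrivial_circle_prob M"
  shows "norm (fps_nth (schur_iterate_fps M n) k) \<le> 1"
proof (rule fps_nth_norm_le_of_bounded)
  show "schur_iterate M n holomorphic_on ball 0 1"
    by (rule holomorphic_schur_iterate[OF M])
  show "schur_iterate M n has_fps_expansion schur_iterate_fps M n"
    by (rule has_fps_expansion_schur_iterate[OF M])
  show "norm (schur_iterate M n z) \<le> 1" if "norm z < 1" for z
    using schur_iterate_bound[OF M that] by blast
qed

text \<open>Since the iterate at index \<open>n + 1\<close> arises from the one at index \<open>n\<close>, its Schur parameters are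
  \<open>- cnj \<alpha>\<^sub>n, - cnj \<alpha>\<^bsub>n-1\<^esub>, \<dots>, - cnj \<alpha>\<^sub>0\<close>, followed by \<open>1\<close>.\<close>

lemma schur_step_schur_iterate:
  assumes M: "nontrivial_circle_prob M"
  shows "schur_step (verblunsky M (int n)) (schur_iterate_fps M (Suc n)) (schur_iterate_fps M n)"
proof -
  define a where "a = verblunsky M (int n)"
  define F where "F = schur_iterate_fps M"
  define R where "R = (\<lambda>m. fps_of_poly (reversed_OP M m))"
  have unit: "fps_nth (R m) 0 \<noteq> 0" for m
    using poly_reversed_OP_0[OF M, of m] by (simp add: R_def poly_0_coeff_0)
  then have nz: "R m \<noteq> 0" for m
    by (metis fps_zero_nth)
  have FR: "F m * R m = fps_of_poly (monic_OP M m)" for m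
    using unit[of m] unfolding F_def R_def schur_iterate_fps_def
    by (simp add: fps_divide_unit mult.assoc inverse_mult_eq_1 del: fps_of_poly_nth)
  have "monic_OP M (Suc n) = [:0, 1:] * monic_OP M n - smult (cnj a) (reversed_OP M n)"
    by (simp add: monic_OP_Suc[OF M] a_def)
  then have P': "F (Suc n) * R (Suc n) = (fps_X * F n - fps_const (cnj a)) * R n"
    unfolding left_diff_distrib mult.assoc FR
    by (simp only: R_def fps_of_poly_diff fps_of_poly_mult fps_of_poly_smult fps_of_poly_fps_X)
  have "reversed_OP M (Suc n) = reversed_OP M n - smult a ([:0, 1:] * monic_OP M n)"
    by (rule poly_ext) (simp add: poly_reversed_OP_Suc[OF M] a_def)
  then have R': "R (Suc n) = (1 - fps_const a * (fps_X * F n)) * R n"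
    unfolding left_diff_distrib mult.assoc FR mult_1_left
    by (simp only: R_def fps_of_poly_diff fps_of_poly_mult fps_of_poly_smult fps_of_poly_fps_X)
  have "(F (Suc n) * (1 - fps_const a * (fps_X * F n))) * R n =
      (fps_X * F n - fps_const (cnj a)) * R n"
    using P' unfolding R' by (simp only: mult.assoc)
  then show ?thesis
    unfolding schur_step_def using nz[of n] by (simp add: F_def a_def)
qed

section \<open>Ratio asymptotics\<close>

theorem theorem1p5:
  fixes \<mu> \<nu> :: "complex measure"
  assumes "nontrivial_circle_prob \<mu>" and "nontrivial_circle_prob \<nu>"
  shows "(\<forall>K. compact K \<and> K \<subseteq> ball 0 1 \<longrightarrow>
            uniform_limit K
              (\<lambda>n z. poly (reversed_OP \<mu> (Suc n)) z / poly (reversed_OP \<mu> n) z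
                   - poly (reversed_OP \<nu> (Suc n)) z / poly (reversed_OP \<nu> n) z)
              (\<lambda>_. 0) sequentially)
     \<longleftrightarrow>
         (\<forall>l::nat. l \<ge> 1 \<longrightarrow>
            (\<lambda>n::nat. verblunsky \<mu> (int n) * cnj (verblunsky \<mu> (int n - int l))
                    - verblunsky \<nu> (int n) * cnj (verblunsky \<nu> (int n - int l)))
              \<longlonglongrightarrow> 0)"
proof -
  define a b where "a = (\<lambda>n. verblunsky \<mu> (int n))" and "b = (\<lambda>n. verblunsky \<nu> (int n))"
  define F K where "F = schur_iterate_fps \<mu>" and "K = schur_iterate_fps \<nu>"
  define h where "h = (\<lambda>n z. b n * (z * schur_iterate \<nu> n z) - a n * (z * schur_iterate \<mu> n z))"
  define P where "P = (\<lambda>n. fps_const (b n) * (fps_X * K n) - fps_const (a n) * (fps_X * F n))"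

  have ratio: "poly (reversed_OP M (Suc n)) z / poly (reversed_OP M n) z =
      1 - verblunsky M (int n) * (z * schur_iterate M n z)"
    if "nontrivial_circle_prob M" "norm z < 1" for M n z
    using schur_iterate_bound[OF that, of n]
    by (simp add: poly_reversed_OP_Suc[OF that(1)] schur_iterate_def diff_divide_distrib)
  have bound: "norm (verblunsky M (int n) * (z * schur_iterate M n z)) \<le> 1"
    if "nontrivial_circle_prob M" "norm z < 1" for M n z
    using norm_verblunsky_less_1[OF that(1), of n] schur_iterate_bound[OF that, of n] that(2)
    by (auto simp: norm_mult intro!: mult_le_one)

  \<comment> \<open>On the disc the difference of ratios is \<open>h\<close>; outside it the two may differ at zeros of the
    denominators.\<close>
  have "(\<forall>K. compact K \<and> K \<subseteq> ball 0 1 \<longrightarrow>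
            uniform_limit K
              (\<lambda>n z. poly (reversed_OP \<mu> (Suc n)) z / poly (reversed_OP \<mu> n) z
                   - poly (reversed_OP \<nu> (Suc n)) z / poly (reversed_OP \<nu> n) z)
              (\<lambda>_. 0) sequentially) \<longleftrightarrow>
        (\<forall>K. compact K \<and> K \<subseteq> ball 0 1 \<longrightarrow> uniform_limit K h (\<lambda>_. 0) sequentially)"
  proof (intro all_cong1 imp_cong refl uniform_limit_cong' allI)
    fix K n and z :: complex
    assume "compact K \<and> K \<subseteq> ball 0 1" "z \<in> K"
    then have "norm z < 1"
      by auto
    then show "poly (reversed_OP \<mu> (Suc n)) z / poly (reversed_OP \<mu> n) z
        - poly (reversed_OP \<nu> (Suc n)) z / poly (reversed_OP \<nu> n) z = h n z"
      by (simp add: ratio assms h_def a_def b_def)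
  qed
  also have "\<dots> \<longleftrightarrow> (\<forall>k. (\<lambda>n. fps_nth (P n) k) \<longlonglongrightarrow> 0)"
  proof (rule locally_uniform_limit_iff_fps_nth_tendsto)
    show "h n holomorphic_on ball 0 1" for n
      unfolding h_def by (intro holomorphic_intros holomorphic_schur_iterate assms)
    show "h n has_fps_expansion P n" for n
      unfolding h_def P_def F_def K_def
      by (intro fps_expansion_intros has_fps_expansion_schur_iterate assms)
    show "norm (h n z) \<le> 2" if "norm z < 1" for n z
      using norm_triangle_ineq4[of "b n * (z * schur_iterate \<nu> n z)" "a n * (z * schur_iterate \<mu> n z)"]
        bound[OF assms(1) that, of n] bound[OF assms(2) that, of n]
      by (simp add: h_def a_def b_def)
  qed
  \<comment> \<open>The factor \<open>z\<close> only shifts the coefficients by one.\<close>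
  also have "\<dots> \<longleftrightarrow> (\<forall>k. (\<lambda>n. a n * fps_nth (F n) k - b n * fps_nth (K n) k) \<longlonglongrightarrow> 0)"
  proof -
    have "(\<forall>k. (\<lambda>n. fps_nth (P n) k) \<longlonglongrightarrow> 0) \<longleftrightarrow> (\<forall>k. (\<lambda>n. fps_nth (P n) (Suc k)) \<longlonglongrightarrow> 0)"
    proof (intro iffI allI)
      fix k
      assume "\<forall>k. (\<lambda>n. fps_nth (P n) (Suc k)) \<longlonglongrightarrow> 0"
      then show "(\<lambda>n. fps_nth (P n) k) \<longlonglongrightarrow> 0"
        by (cases k) (simp_all add: P_def)
    qed simp
    moreover have "fps_nth (P n) (Suc k) = - (a n * fps_nth (F n) k - b n * fps_nth (K n) k)" for n k
      by (simp add: P_def)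
    ultimately show ?thesis
      by (simp only: tendsto_minus_cancel_left[where 'b = complex, symmetric] minus_zero
          tendsto_minus_cancel_left)
  qed
  also have "\<dots> \<longleftrightarrow> (\<forall>l\<ge>1. (\<lambda>n. a n * cnj (a (n - l)) - b n * cnj (b (n - l))) \<longlonglongrightarrow> 0)"
    unfolding a_def b_def F_def K_def
    by (intro schur_flow_tendsto_iff_products_tendsto schur_step_schur_iterate
        norm_fps_nth_schur_iterate assms)
  also have "\<dots> \<longleftrightarrow> (\<forall>l::nat. l \<ge> 1 \<longrightarrow>
      (\<lambda>n::nat. verblunsky \<mu> (int n) * cnj (verblunsky \<mu> (int n - int l))
              - verblunsky \<nu> (int n) * cnj (verblunsky \<nu> (int n - int l))) \<longlonglongrightarrow> 0)"
  proof (intro all_cong1 imp_cong refl tendsto_cong)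
    fix l :: nat
    show "\<forall>\<^sub>F n in sequentially. a n * cnj (a (n - l)) - b n * cnj (b (n - l)) =
        verblunsky \<mu> (int n) * cnj (verblunsky \<mu> (int n - int l))
          - verblunsky \<nu> (int n) * cnj (verblunsky \<nu> (int n - int l))"
      using eventually_ge_at_top[of l]
      by eventually_elim (simp add: a_def b_def of_nat_diff)
  qed
  finally show ?thesis .
qed

end
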